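(* If $q$ is not integral over the canonical image of $\mathbb{Z}$ in $\Bbbk$, then the Lie algebra $\widetilde{\mathfrak{EH}}$ (with its projection $\widetilde{\mathfrak{EH}} \to \mathfrak{EH}$, $w_{\mathbf x} \mapsto w_{\mathbf x}$, $\mathbf{Z}_\Bbbk \to 0$) is the universal central extension of $\mathfrak{EH}$.
   Context: $\Bbbk$ is an integral domain and $q \in \Bbbk^\times$ is such that $\{d\} := q^d - q^{-d} \in \Bbbk^\times$ for all integers $d \ne 0$. Let $\mathbf{Z} := \mathbb{Z}^2$, $\mathbf{Z}^* := \mathbf{Z}\setminus\{(0,0)\}$, $\mathbf{Z}_\Bbbk := \Bbbk\otimes_{\mathbb{Z}}\mathbf{Z} \cong \Bbbk^2$. $\mathfrak{EH}$ is the Lie algebra over $\Bbbk$ with $\Bbbk$-basis $w_{\mathbf x}$, $\mathbf x \in \mathbf{Z}^*$, and Lie bracket $[w_{\mathbf x}, w_{\mathbf y}] = \{d\}\,w_{\mathbf x+\mathbf y}$, where $d = \det(\mathbf x\ \mathbf y)$ is the determinant of the matrix with columns $\mathbf x,\mathbf y$, and $w_{(0,0)} := 0$. $\widetilde{\mathfrak{EH}} = \mathfrak{EH}\oplus\mathbf{Z}_\Bbbk$ as a $\Bbbk$-module, with Lie bracket given by the fact that the elements of $\mathbf{Z}_\Bbbk$ are central and $[w_{\mathbf x}, w_{\mathbf y}] = \{d\}\,w_{\mathbf x+\mathbf y} + \delta_{\mathbf x,-\mathbf y}\,\mathbf x$, $d = \det(\mathbf x\ \mathbf y)$, where the last $\mathbf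 x$ is viewed in $\mathbf{Z}_\Bbbk$. *)

theory Defs
  imports
    "HOL-Library.Poly_Mapping"
    "HOL-Library.Product_Plus"
    "HOL-Computational_Algebra.Polynomial"
begin

section \<open>Lie algebras and central extensions over a commutative ring\<close>

locale lie_algebra = module scale
  for scale :: "'k::comm_ring_1 \<Rightarrow> 'a::ab_group_add \<Rightarrow> 'a" +
  fixes bracket :: "'a \<Rightarrow> 'a \<Rightarrow> 'a"
  assumes bracket_add_left: "bracket (x + y) z = bracket x z + bracket y z"
    and bracket_add_right: "bracket x (y + z) = bracket x y + bracket x z"
    and bracket_scale_left: "bracket (scale c x) y = scale c (bracket x y)"
    and bracket_scale_right: "bracket x (scale c y) = scale c (bracket x y)"
    and bracket_self: "bracket x x = 0"
    and jacobi: "bracket x (bracket y z) + bracket y (bracket z x) + bracket z (bracket x y) = 0"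

locale lie_hom =
  A: lie_algebra scaleA bracketA + B: lie_algebra scaleB bracketB + module_hom scaleA scaleB f
  for scaleA :: "'k::comm_ring_1 \<Rightarrow> 'a::ab_group_add \<Rightarrow> 'a" and bracketA :: "'a \<Rightarrow> 'a \<Rightarrow> 'a"
    and scaleB :: "'k \<Rightarrow> 'b::ab_group_add \<Rightarrow> 'b" and bracketB :: "'b \<Rightarrow> 'b \<Rightarrow> 'b"
    and f :: "'a \<Rightarrow> 'b" +
  assumes hom_bracket: "f (bracketA x y) = bracketB (f x) (f y)"

locale central_extension = lie_hom scaleE bracketE scaleL bracketL p
  for scaleE :: "'k::comm_ring_1 \<Rightarrow> 'e::ab_group_add \<Rightarrow> 'e" and bracketE :: "'e \<Rightarrow> 'e \<Rightarrow> 'e"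
    and scaleL :: "'k \<Rightarrow> 'l::ab_group_add \<Rightarrow> 'l" and bracketL :: "'l \<Rightarrow> 'l \<Rightarrow> 'l"
    and p :: "'e \<Rightarrow> 'l" +
  assumes surj: "surj p"
    and kernel_central: "p z = 0 \<Longrightarrow> bracketE z x = 0"

text \<open>
  A HOL definition cannot quantify over types, so the type \<open>'c\<close> carrying the central extensions
  against which universality is tested is a parameter. A theorem that leaves \<open>'c\<close> a free type
  variable asserts the universal property against all central extensions.
\<close>

definition universal_central_extension ::
  "'c::ab_group_add itself \<Rightarrow>
   ('k::comm_ring_1 \<Rightarrow> 'u::ab_group_add \<Rightarrow> 'u) \<Rightarrow> ('u \<Rightarrow> 'u \<Rightarrow> 'u) \<Rightarrow>
   ('k \<Rightarrow> 'l::ab_group_add \<Rightarrow> 'l) \<Rightarrow> ('l \<Rightarrow> 'l \<Rightarrow> 'l) \<Rightarrow> ('u \<Rightarrow> 'l) \<Rightarrow> bool" where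
  "universal_central_extension _ scaleU bracketU scaleL bracketL p \<longleftrightarrow>
     central_extension scaleU bracketU scaleL bracketL p \<and>
     (\<forall>(scaleC :: 'k \<Rightarrow> 'c \<Rightarrow> 'c) bracketC f.
        central_extension scaleC bracketC scaleL bracketL f \<longrightarrow>
        (\<exists>!\<phi>. lie_hom scaleU bracketU scaleC bracketC \<phi> \<and> f \<circ> \<phi> = p))"


section \<open>Integrality and quantum integers\<close>

text \<open>The library's \<open>algebraic_int\<close> is restricted to fields. Here \<open>\<int>\<close> is the image of the
  integers in \<open>'k\<close>.\<close>

definition integral_over_ints :: "'k::idom \<Rightarrow> bool" where
  "integral_over_ints x \<longleftrightarrow>
     (\<exists>p. lead_coeff p = 1 \<and> (\<forall>i. coeff p i \<in> \<int>) \<and> poly p x = 0)"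

text \<open>\<open>powi\<close> needs a division operation on the type, so integer powers of a unit are defined
  here. Both definitions below are meaningful only if \<open>q dvd 1\<close>.\<close>

definition unit_inv :: "'k::idom \<Rightarrow> 'k" where
  "unit_inv q = (THE r. q * r = 1)"

definition unit_powi :: "'k::idom \<Rightarrow> int \<Rightarrow> 'k" where
  "unit_powi q d = (if d \<ge> 0 then q ^ nat d else unit_inv q ^ nat (- d))"

definition qint :: "'k::idom \<Rightarrow> int \<Rightarrow> 'k" where
  "qint q d = unit_powi q d - unit_powi q (- d)"


section \<open>The Lie algebra \<open>EH\<close>\<close>

definition det2 :: "int \<times> int \<Rightarrow> int \<times> int \<Rightarrow> int" where
  "det2 x y = fst x * snd y - fst y * snd x"

typedef zstar = "{x :: int \<times> int. x \<noteq> (0, 0)}"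
  morphisms vec Zstar
  by (rule exI[of _ "(1, 0)"]) simp

text \<open>The free module on the nonzero integer vectors: finitely supported functions.\<close>

type_synonym 'k eh = "zstar \<Rightarrow>\<^sub>0 'k"

definition eh_scale :: "'k::idom \<Rightarrow> 'k eh \<Rightarrow> 'k eh" where
  "eh_scale c f = Poly_Mapping.map ((*) c) f"

text \<open>\<open>eh_w (vec x)\<close> is the basis vector at \<open>x\<close>; \<open>eh_w (0, 0) = 0\<close> by convention.\<close>

definition eh_w :: "int \<times> int \<Rightarrow> 'k::idom eh" where
  "eh_w x = (if x = (0, 0) then 0 else Poly_Mapping.single (Zstar x) 1)"

definition bilinear_extension ::
  "('k \<Rightarrow> 'b \<Rightarrow> 'b) \<Rightarrow> (zstar \<Rightarrow> zstar \<Rightarrow> 'b) \<Rightarrow> 'k::idom eh \<Rightarrow> 'k eh \<Rightarrow> 'b::ab_group_add" where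
  "bilinear_extension scale B f g =
     (\<Sum>x\<in>Poly_Mapping.keys f. \<Sum>y\<in>Poly_Mapping.keys g.
        scale (Poly_Mapping.lookup f x * Poly_Mapping.lookup g y) (B x y))"

definition eh_bracket :: "'k::idom \<Rightarrow> 'k eh \<Rightarrow> 'k eh \<Rightarrow> 'k eh" where
  "eh_bracket q = bilinear_extension eh_scale
     (\<lambda>x y. eh_scale (qint q (det2 (vec x) (vec y))) (eh_w (vec x + vec y)))"


section \<open>The Lie algebra \<open>EH\<close> extended by \<open>\<int>\<^sup>2 \<otimes> 'k\<close>\<close>

text \<open>\<open>\<int>\<^sup>2 \<otimes> 'k\<close> is identified with \<open>'k \<times> 'k\<close>; \<open>zk\<close> is the canonical map from \<open>\<int>\<^sup>2\<close>.\<close>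

type_synonym 'k eh_tilde = "'k eh \<times> ('k \<times> 'k)"

definition zk :: "int \<times> int \<Rightarrow> 'k::idom \<times> 'k" where
  "zk x = (of_int (fst x), of_int (snd x))"

definition eh_tilde_scale :: "'k::idom \<Rightarrow> 'k eh_tilde \<Rightarrow> 'k eh_tilde" where
  "eh_tilde_scale c u = (eh_scale c (fst u), (c * fst (snd u), c * snd (snd u)))"

definition eh_tilde_bracket :: "'k::idom \<Rightarrow> 'k eh_tilde \<Rightarrow> 'k eh_tilde \<Rightarrow> 'k eh_tilde" where
  "eh_tilde_bracket q u v = bilinear_extension eh_tilde_scale
     (\<lambda>x y. (eh_scale (qint q (det2 (vec x) (vec y))) (eh_w (vec x + vec y)),
             if vec x = - vec y then zk (vec x) else 0))
     (fst u) (fst v)"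

definition eh_proj :: "'k::idom eh_tilde \<Rightarrow> 'k eh" where
  "eh_proj = fst"


section \<open>The brackets on basis vectors\<close>

lemma eh_scale_1 [simp]: "eh_scale 1 f = f"
  unfolding eh_scale_def
  by (rule poly_mapping_eqI) (simp add: Poly_Mapping.map.rep_eq when_def)

lemma eh_bracket_w:
  fixes q :: "'k::idom"
  assumes "x \<noteq> (0, 0)" "y \<noteq> (0, 0)"
  shows "eh_bracket q (eh_w x) (eh_w y) = eh_scale (qint q (det2 x y)) (eh_w (x + y))"
  using assms by (simp add: eh_bracket_def bilinear_extension_def eh_w_def Zstar_inverse)

lemma eh_tilde_scale_1 [simp]: "eh_tilde_scale 1 u = u"
  by (simp add: eh_tilde_scale_def)

lemma eh_tilde_bracket_w:
  fixes q :: "'k::idom"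
  assumes "x \<noteq> (0, 0)" "y \<noteq> (0, 0)"
  shows "eh_tilde_bracket q (eh_w x, a) (eh_w y, b) =
    (eh_scale (qint q (det2 x y)) (eh_w (x + y)), if x = - y then zk x else 0)"
proof -
  have "eh_w x = Poly_Mapping.single (Zstar x) (1::'k)" "eh_w y = Poly_Mapping.single (Zstar y) (1::'k)"
    using assms by (simp_all add: eh_w_def)
  moreover have "Poly_Mapping.keys (Poly_Mapping.single z (1::'k)) = {z}" for z :: zstar
    by simp
  ultimately show ?thesis
    using assms by (simp only: eh_tilde_bracket_def bilinear_extension_def fst_conv sum.insert
      finite.emptyI empty_iff sum.empty Zstar_inverse mem_Collect_eq lookup_single_eq
      mult_1 eh_tilde_scale_1 add_0_right not_False_eq_True)
qed

end

theory Submission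
  imports Defs
begin

text \<open>
  Write \<open>{d}\<close> for \<open>qint q d\<close>. Let \<open>p\<close> be a central extension of \<open>EH\<close> and choose preimages
  \<open>u x\<close> of the basis vectors \<open>w\<^sub>x\<close>, with \<open>u 0 = 0\<close>. For a fixed degree \<open>s\<close> the defect
  \<open>F x = [u x, u (s - x)] - {det(x s)} u s\<close> takes values in the kernel of \<open>p\<close>. Brackets in the
  extension depend only on images under \<open>p\<close>, so the Jacobi identity for \<open>u x, u y, u (s - x - y)\<close>
  becomes one linear functional equation for \<open>F\<close>, here called the defect equation. Its solutions
  are of two kinds, according to \<open>s\<close>.

  If \<open>s \<noteq> 0\<close>, then \<open>F x = {det(x s)} k\<close> with \<open>k\<close> in the kernel, so replacing \<open>u s\<close> by \<open>u s + k\<close>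
  removes the defect (\<open>defect_equation_solution\<close>). The reason: an integral change of basis moves
  \<open>s\<close> to \<open>(0, n)\<close>; after subtraction of a solution of the stated form, \<open>F (1, 0) = 0\<close>. The
  equation then makes the rows \<open>0\<close> and \<open>n\<close> vanish and expresses every other row \<open>F (\<cdot>, j)\<close> through
  one of its values, by steps of any length. Comparing the answers for steps of length one, two
  and three kills the row unless \<open>n = 2 j\<close>, and the remaining row is reached by adding points of
  other rows.

  If \<open>s = 0\<close>, then \<open>F x = [u x, u (- x)]\<close> and the equation says \<open>{det(x y)} (F x + F y - F (x + y)) = 0\<close>.
  So \<open>F\<close> is additive on linearly independent pairs, and a detour through a transversal vector makes
  it additive everywhere (\<open>defect_equation_additive\<close>). Hence \<open>F\<close> extends to a linear map on
  \<open>\<int>\<^sup>2 \<otimes> 'k\<close>. Corrected lifts and this linear map together are the homomorphism from the extended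
  Lie algebra.

  All divisions in these arguments are by \<open>{d}\<close> with \<open>d \<noteq> 0\<close>, never by integers: the kernel may
  have torsion. Uniqueness holds because the extended algebra is perfect: \<open>w\<^sub>x\<close> is a multiple of
  \<open>[w\<^sub>y, w\<^bsub>x-y\<^esub>]\<close> for any \<open>y\<close> not parallel to \<open>x\<close>, and the central element \<open>x\<close> is
  \<open>[w\<^sub>x, w\<^bsub>-x\<^esub>]\<close>. Two homomorphisms over \<open>EH\<close> agree on all brackets, as they differ by central
  elements.
\<close>

section \<open>Quantum integers\<close>

lemma unit_inv_right:
  fixes q :: "'k::idom"
  assumes "q dvd 1"
  shows "q * unit_inv q = 1"
proof -
  obtain r where r: "1 = q * r" using assms by (elim dvdE)
  have "q \<noteq> 0" using r by auto
  have "unit_inv q = r"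
    unfolding unit_inv_def
  proof (rule the_equality)
    fix r' assume "q * r' = 1"
    then have "q * r' = q * r" using r by simp
    then show "r' = r" using \<open>q \<noteq> 0\<close> by simp
  qed (use r in simp)
  then show ?thesis using r by simp
qed

lemma unit_powi_0 [simp]: "unit_powi q 0 = 1"
  by (simp add: unit_powi_def)

lemma unit_powi_succ:
  fixes q :: "'k::idom"
  assumes "q dvd 1"
  shows "unit_powi q (d + 1) = q * unit_powi q d"
proof (cases "d \<ge> 0")
  case True
  then have "nat (d + 1) = Suc (nat d)" by simp
  with True show ?thesis by (simp add: unit_powi_def)
next
  case False
  then have "nat (- d) = Suc (nat (- (d + 1)))" by simp
  then have "unit_powi q d = unit_inv q * unit_inv q ^ nat (- (d + 1))"
    using False by (simp add: unit_powi_def)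
  moreover have "unit_powi q (d + 1) = unit_inv q ^ nat (- (d + 1))"
    using False by (cases "d = -1") (simp_all add: unit_powi_def)
  ultimately show ?thesis
    by (simp only: mult.assoc[symmetric] unit_inv_right[OF assms] mult_1)
qed

lemma unit_powi_add:
  fixes q :: "'k::idom"
  assumes "q dvd 1"
  shows "unit_powi q (c + d) = unit_powi q c * unit_powi q d"
proof (induction c rule: int_induct[where k = 0])
  case base
  show ?case by simp
next
  case (step1 i)
  have "unit_powi q (i + 1 + d) = unit_powi q (i + d + 1)" by (simp add: algebra_simps)
  then show ?case using step1 by (simp add: unit_powi_succ[OF assms])
next
  case (step2 i)
  have "q \<noteq> 0" using assms by auto
  have "q * unit_powi q (i - 1 + d) = unit_powi q (i + d)"
    using unit_powi_succ[OF assms, of "i - 1 + d"] by (simp add: algebra_simps)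
  also have "\<dots> = q * unit_powi q (i - 1) * unit_powi q d"
    using step2 unit_powi_succ[OF assms, of "i - 1"] by simp
  finally show ?case using \<open>q \<noteq> 0\<close> by simp
qed

lemma qint_0 [simp]: "qint q 0 = 0"
  by (simp add: qint_def)

lemma qint_minus: "qint q (- d) = - qint q d"
  by (simp add: qint_def)

locale quantum_units =
  fixes q :: "'k::idom"
  assumes q_unit: "q dvd 1"
    and qint_unit: "d \<noteq> 0 \<Longrightarrow> qint q d dvd 1"
begin

abbreviation Q :: "int \<Rightarrow> 'k" where "Q \<equiv> unit_powi q"

lemmas Q_add = unit_powi_add[OF q_unit]

lemma Q_inverse: "Q d * Q (- d) = 1"
  using Q_add[of d "- d"] by simp

text \<open>
  A \<open>q\<close>-analogue of \<open>(a + y) x + (a - x) y = a (x + y)\<close>. It is the Jacobi identity for the brackets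
  in disguise, and it also says that \<open>x \<mapsto> {det(x s)}\<close> solves the defect equation of degree \<open>s\<close>.
\<close>

lemma qint_addition:
  "qint q (a + y) * qint q x + qint q (a - x) * qint q y = qint q a * qint q (x + y)"
proof -
  have "Q (a + y) = Q a * Q y" "Q (- (a + y)) = Q (- a) * Q (- y)"
    "Q (a - x) = Q a * Q (- x)" "Q (- (a - x)) = Q (- a) * Q x"
    "Q (x + y) = Q x * Q y" "Q (- (x + y)) = Q (- x) * Q (- y)"
    using Q_add[of a y] Q_add[of "- a" "- y"] Q_add[of a "- x"] Q_add[of "- a" x]
      Q_add[of x y] Q_add[of "- x" "- y"] by (simp_all add: algebra_simps)
  then show ?thesis unfolding qint_def by (simp only:) (simp add: algebra_simps)
qed

lemma qint_double: "qint q (2 * m) = qint q m * (Q m + Q (- m))"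
proof -
  have "Q (2 * m) = Q m * Q m" "Q (- (2 * m)) = Q (- m) * Q (- m)"
    using Q_add[of m m] Q_add[of "- m" "- m"] by (simp_all add: algebra_simps)
  then show ?thesis unfolding qint_def by (simp only:) (simp add: algebra_simps)
qed

lemma qint_triple: "qint q (3 * m) = qint q m * (qint q m ^ 2 + 3)"
proof -
  have "Q (3 * m) = Q m ^ 3" "Q (- (3 * m)) = Q (- m) ^ 3"
    using Q_add[of m "2 * m"] Q_add[of m m] Q_add[of "- m" "- 2 * m"] Q_add[of "- m" "- m"]
    by (simp_all add: power3_eq_cube algebra_simps)
  then have "qint q (3 * m) = Q m ^ 3 - Q (- m) ^ 3" by (simp only: qint_def)
  also have "\<dots> = (Q m - Q (- m)) * ((Q m - Q (- m)) ^ 2 + 3 * (Q m * Q (- m)))"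
    by algebra
  finally show ?thesis by (simp add: Q_inverse qint_def)
qed

text \<open>
  The next two identities measure how far the ratio \<open>{j - n} / {j}\<close> is from satisfying the
  relations that steps of length two and three force on it (see \<open>defect_row_vanishes\<close>). The first
  discrepancy is a unit up to the factor \<open>2\<close>, which leaves \<open>2\<close>-torsion to be excluded by the second.
\<close>

lemma qint_double_cross:
  "qint q j * (Q (j - n) + Q (- (j - n))) - qint q (j - n) * (Q j + Q (- j)) = 2 * qint q n"
proof -
  have e: "Q (j - n) = Q j * Q (- n)" "Q (- (j - n)) = Q (- j) * Q n"
    using Q_add[of j "- n"] Q_add[of "- j" n] by (simp_all add: algebra_simps)
  have "qint q j * (Q (j - n) + Q (- (j - n))) - qint q (j - n) * (Q j + Q (- j))
      = 2 * (Q j * Q (- j)) * qint q n"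
    unfolding qint_def e by (simp add: algebra_simps)
  then show ?thesis by (simp add: Q_inverse)
qed

lemma qint_square_diff:
  "qint q j ^ 2 - qint q (j - n) ^ 2 = qint q n * qint q (2 * j - n)"
proof -
  have e: "Q (j - n) = Q j * Q (- n)" "Q (- (j - n)) = Q (- j) * Q n"
    "Q (2 * j - n) = Q j * Q j * Q (- n)" "Q (- (2 * j - n)) = Q (- j) * Q (- j) * Q n"
    using Q_add[of j "- n"] Q_add[of "- j" n] Q_add[of "2 * j" "- n"] Q_add[of j j]
      Q_add[of "- 2 * j" n] Q_add[of "- j" "- j"] by (simp_all add: algebra_simps)
  show ?thesis
    unfolding qint_def e using Q_inverse[of j] Q_inverse[of n] by algebra
qed

end


section \<open>Linear and bilinear extension from the basis\<close>

definition lin_ext :: "('k \<Rightarrow> 'b \<Rightarrow> 'b) \<Rightarrow> (zstar \<Rightarrow> 'b) \<Rightarrow> 'k::idom eh \<Rightarrow> 'b::ab_group_add" where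
  "lin_ext scale g f = (\<Sum>x\<in>Poly_Mapping.keys f. scale (Poly_Mapping.lookup f x) (g x))"

lemma lookup_eh_scale: "Poly_Mapping.lookup (eh_scale c f) x = c * Poly_Mapping.lookup f x"
  by (simp add: eh_scale_def Poly_Mapping.map.rep_eq when_def)

locale idom_module = module scale
  for scale :: "'k::idom \<Rightarrow> 'b::ab_group_add \<Rightarrow> 'b"
begin

lemma lin_ext_sum_superset:
  assumes "finite S" "Poly_Mapping.keys f \<subseteq> S"
  shows "lin_ext scale g f = (\<Sum>x\<in>S. scale (Poly_Mapping.lookup f x) (g x))"
  unfolding lin_ext_def using assms
  by (intro sum.mono_neutral_left) (auto simp: in_keys_iff)

lemma lin_ext_add: "lin_ext scale g (f + h) = lin_ext scale g f + lin_ext scale g h"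
  unfolding lin_ext_def
  by (rule setsum_keys_plus_distrib) (simp_all add: scale_left_distrib)

lemma lin_ext_scale: "lin_ext scale g (eh_scale c f) = scale c (lin_ext scale g f)"
proof -
  have "Poly_Mapping.keys (eh_scale c f) \<subseteq> Poly_Mapping.keys f"
    by (auto simp: in_keys_iff lookup_eh_scale)
  then show ?thesis
    by (subst lin_ext_sum_superset[of "Poly_Mapping.keys f"])
      (simp_all add: lookup_eh_scale lin_ext_def scale_sum_right)
qed

lemma lin_ext_w: "lin_ext scale (\<lambda>z. g (vec z)) (eh_w x) = (if x = 0 then 0 else g x)"
  by (auto simp: lin_ext_def eh_w_def Zstar_inverse zero_prod_def)

lemma bilinear_extension_lin_ext:
  "bilinear_extension scale B f g = lin_ext scale (\<lambda>x. lin_ext scale (B x) g) f"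
  by (simp add: bilinear_extension_def lin_ext_def scale_sum_right)

lemma bilinear_extension_bilinear:
  "bilinear_extension scale B (f + f') g = bilinear_extension scale B f g + bilinear_extension scale B f' g"
  "bilinear_extension scale B f (g + g') = bilinear_extension scale B f g + bilinear_extension scale B f g'"
  "bilinear_extension scale B (eh_scale c f) g = scale c (bilinear_extension scale B f g)"
  "bilinear_extension scale B f (eh_scale c g) = scale c (bilinear_extension scale B f g)"
  by (simp_all add: bilinear_extension_lin_ext lin_ext_add lin_ext_scale)
    (simp_all add: lin_ext_def scale_right_distrib sum.distrib scale_sum_right ac_simps)

end

interpretation eh: idom_module "eh_scale :: 'k::idom \<Rightarrow> 'k eh \<Rightarrow> 'k eh"
  by unfold_locales
    (auto intro!: poly_mapping_eqI simp: lookup_eh_scale lookup_add algebra_simps)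

interpretation eh_tilde: idom_module "eh_tilde_scale :: 'k::idom \<Rightarrow> 'k eh_tilde \<Rightarrow> 'k eh_tilde"
  by unfold_locales (auto simp: eh_tilde_scale_def eh.scale_right_distrib eh.scale_left_distrib algebra_simps)

lemma eh_w_zero [simp]: "eh_w (0, 0) = 0" "eh_w 0 = 0"
  by (simp_all add: eh_w_def zero_prod_def)

lemma eh_w_vec: "eh_w (vec x) = Poly_Mapping.single x 1"
  using vec[of x] by (simp add: eh_w_def vec_inverse)

lemma eh_induct [case_names add scale basis]:
  assumes add: "\<And>f g. P f \<Longrightarrow> P g \<Longrightarrow> P (f + g)"
    and scale: "\<And>c f. P f \<Longrightarrow> P (eh_scale c f)"
    and basis: "\<And>x. P (eh_w x)"
  shows "P (f :: 'k::idom eh)"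
proof (induction f rule: Poly_Mapping.update_induct)
  case const
  show ?case using scale[OF basis, of 0 0] by simp
next
  case (update f a b)
  have "Poly_Mapping.update a b f = f + eh_scale b (eh_w (vec a))"
    using update.hyps
    by (intro poly_mapping_eqI)
      (auto simp: lookup_update lookup_add lookup_eh_scale eh_w_vec lookup_single in_keys_iff when_def)
  then show ?case using add[OF update.IH scale[OF basis]] by simp
qed

section \<open>The two Lie algebras\<close>

lemma det2_simps:
  "det2 (x + y) z = det2 x z + det2 y z" "det2 x (y + z) = det2 x y + det2 x z"
  "det2 (x - y) z = det2 x z - det2 y z" "det2 x (y - z) = det2 x y - det2 x z"
  "det2 (- x) y = - det2 x y" "det2 x (- y) = - det2 x y"
  "det2 x x = 0" "det2 0 x = 0" "det2 x 0 = 0"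
  by (simp_all add: det2_def algebra_simps)

lemma det2_commute: "det2 y x = - det2 x y"
  by (simp add: det2_def algebra_simps)

lemma zk_simps: "zk (x + y) = zk x + zk y" "zk 0 = 0" "zk (- x) = - zk x"
  by (simp_all add: zk_def zero_prod_def plus_prod_def uminus_prod_def)

lemma fst_eh_tilde_scale: "fst (eh_tilde_scale c u) = eh_scale c (fst u)"
  by (simp add: eh_tilde_scale_def)

lemma eh_tilde_bracket_bilinear:
  "eh_tilde_bracket q (u + u') v = eh_tilde_bracket q u v + eh_tilde_bracket q u' v"
  "eh_tilde_bracket q u (v + v') = eh_tilde_bracket q u v + eh_tilde_bracket q u v'"
  "eh_tilde_bracket q (eh_tilde_scale c u) v = eh_tilde_scale c (eh_tilde_bracket q u v)"
  "eh_tilde_bracket q u (eh_tilde_scale c v) = eh_tilde_scale c (eh_tilde_bracket q u v)"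
  by (simp_all add: eh_tilde_bracket_def eh_tilde.bilinear_extension_bilinear fst_eh_tilde_scale)

lemma fst_eh_tilde_bracket: "fst (eh_tilde_bracket q u v) = eh_bracket q (fst u) (fst v)"
  by (simp add: eh_tilde_bracket_def eh_bracket_def bilinear_extension_def fst_sum fst_eh_tilde_scale)

lemma eh_tilde_bracket_cong:
  "fst u = fst u' \<Longrightarrow> fst v = fst v' \<Longrightarrow> eh_tilde_bracket q u v = eh_tilde_bracket q u' v'"
  by (simp add: eh_tilde_bracket_def)

lemma eh_bracket_bilinear:
  "eh_bracket q (f + f') g = eh_bracket q f g + eh_bracket q f' g"
  "eh_bracket q f (g + g') = eh_bracket q f g + eh_bracket q f g'"
  "eh_bracket q (eh_scale c f) g = eh_scale c (eh_bracket q f g)"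
  "eh_bracket q f (eh_scale c g) = eh_scale c (eh_bracket q f g)"
  by (simp_all add: eh_bracket_def eh.bilinear_extension_bilinear)

text \<open>
  With \<open>w\<^sub>0 = 0\<close> the formula for the bracket persists at zero vectors, since \<open>{0} = 0\<close>.
  Computations with \<open>w\<^bsub>x+y\<^esub>\<close> therefore need no case distinction on \<open>x + y = 0\<close>.
\<close>

lemma eh_tilde_bracket_w':
  "eh_tilde_bracket q (eh_w x, a) (eh_w y, b) =
    (eh_scale (qint q (det2 x y)) (eh_w (x + y)), if x + y = 0 then zk x else 0)"
proof (cases "x = 0 \<or> y = 0")
  case True
  then show ?thesis
    by (auto simp: eh_tilde_bracket_def bilinear_extension_def det2_simps zk_simps zero_prod_def[symmetric])
next
  case False
  then show ?thesis
    by (simp add: eh_tilde_bracket_w zero_prod_def[symmetric] add_eq_0_iff2)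
qed

lemma eh_bracket_w': "eh_bracket q (eh_w x) (eh_w y) = eh_scale (qint q (det2 x y)) (eh_w (x + y))"
  using fst_eh_tilde_bracket[of q "(eh_w x, 0)" "(eh_w y, 0)"] by (simp add: eh_tilde_bracket_w')

lemma eh_pair_linear:
  "(f + f', 0) = (f, 0) + (f', 0 :: 'k \<times> 'k)"
  "(eh_scale c f, 0) = eh_tilde_scale c (f, 0)" for f f' :: "'k::idom eh"
  by (simp_all add: eh_tilde_scale_def zero_prod_def)

lemma eh_tilde_bracket_antisym:
  "eh_tilde_bracket q (f, 0) (g, 0) = - eh_tilde_bracket q (g, 0) (f, 0)"
proof -
  show ?thesis
  proof (induction f rule: eh_induct)
    case (basis x)
    show ?case
    proof (induction g rule: eh_induct)
      case (basis y)
      show ?case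
        by (auto simp: eh_tilde_bracket_w' det2_commute[of y x] qint_minus add.commute add_eq_0_iff zk_simps)
    qed (simp_all add: eh_pair_linear eh_tilde_bracket_bilinear del: add_Pair)
  qed (simp_all add: eh_pair_linear eh_tilde_bracket_bilinear del: add_Pair)
qed

context quantum_units
begin

text \<open>
  The component in \<open>EH\<close> is the addition identity for quantum integers. The central component
  occurs only if \<open>x + y + z = 0\<close>; then the three determinants coincide and the sum is
  \<open>{det(x y)} (x + y + z) = 0\<close>.
\<close>

lemma eh_tilde_jacobi_w:
  "eh_tilde_bracket q (eh_w x, 0) (eh_tilde_bracket q (eh_w y, 0) (eh_w z, 0))
    + eh_tilde_bracket q (eh_w y, 0) (eh_tilde_bracket q (eh_w z, 0) (eh_w x, 0))
    + eh_tilde_bracket q (eh_w z, 0) (eh_tilde_bracket q (eh_w x, 0) (eh_w y, 0)) = 0"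
proof -
  have nested: "eh_tilde_bracket q (eh_w x, 0) (eh_tilde_bracket q (eh_w y, 0) (eh_w z, 0))
      = eh_tilde_scale (qint q (det2 y z))
          (eh_scale (qint q (det2 x (y + z))) (eh_w (x + y + z)), if x + y + z = 0 then zk x else 0)"
    for x y z
  proof -
    have "eh_tilde_bracket q (eh_w x, 0) (eh_tilde_bracket q (eh_w y, 0) (eh_w z, 0))
        = eh_tilde_bracket q (eh_w x, 0) (eh_tilde_scale (qint q (det2 y z)) (eh_w (y + z), 0))"
      by (rule eh_tilde_bracket_cong) (simp_all add: eh_tilde_bracket_w' fst_eh_tilde_scale)
    then show ?thesis by (simp add: eh_tilde_bracket_bilinear eh_tilde_bracket_w' add.assoc)
  qed
  define s where "s = x + y + z"
  have s: "y + z + x = s" "z + x + y = s" by (simp_all add: s_def algebra_simps)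
  have "det2 y z = det2 x y + det2 y s" "det2 z x = det2 x y - det2 x s"
    "det2 x (y + z) = det2 x s" "det2 y (z + x) = det2 y s"
    "det2 z (x + y) = - (det2 x s + det2 y s)"
    by (simp_all add: s_def det2_def algebra_simps)
  then have coeff: "qint q (det2 y z) * qint q (det2 x (y + z)) + qint q (det2 z x) * qint q (det2 y (z + x))
      + qint q (det2 x y) * qint q (det2 z (x + y)) = 0"
    by (simp only: qint_addition qint_minus) simp
  have fst0: "eh_scale (qint q (det2 y z)) (eh_scale (qint q (det2 x (y + z))) (eh_w s))
      + eh_scale (qint q (det2 z x)) (eh_scale (qint q (det2 y (z + x))) (eh_w s))
      + eh_scale (qint q (det2 x y)) (eh_scale (qint q (det2 z (x + y))) (eh_w s)) = 0"
    using coeff by (simp add: eh.scale_left_distrib[symmetric])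
  show ?thesis
  proof (cases "s = 0")
    case True
    have z: "z = - (x + y)" using True unfolding s_def by (metis add_eq_0_iff)
    have "det2 y z = det2 x y" "det2 z x = det2 x y"
      by (simp_all add: z det2_def algebra_simps)
    moreover have "c * fst (zk x) + c * fst (zk y) + c * fst (zk z) = 0"
      "c * snd (zk x) + c * snd (zk y) + c * snd (zk z) = 0" for c :: 'k
      by (simp_all only: distrib_left[symmetric]) (simp_all add: z zk_def)
    ultimately show ?thesis
      unfolding nested s s_def[symmetric] True
      by (simp add: eh_tilde_scale_def zero_prod_def)
  next
    case False
    then show ?thesis
      unfolding nested s s_def[symmetric] using fst0
      by (simp add: eh_tilde_scale_def zero_prod_def)
  qed
qed

lemma eh_tilde_lie_algebra: "lie_algebra eh_tilde_scale (eh_tilde_bracket q)"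
proof
  show "eh_tilde_bracket q u u = 0" for u
  proof -
    have "eh_tilde_bracket q (f, 0) (f, 0) = 0" for f
    proof (induction f rule: eh_induct)
      case (add f g)
      then show ?case
        using eh_tilde_bracket_antisym[of q f g] by (simp add: eh_pair_linear eh_tilde_bracket_bilinear del: add_Pair)
    next
      case (basis x)
      have "x + x = 0 \<Longrightarrow> x = 0" by (cases x) (simp add: zero_prod_def)
      then show ?case by (auto simp: eh_tilde_bracket_w' det2_simps zk_simps zero_prod_def[symmetric])
    qed (simp_all add: eh_pair_linear eh_tilde_bracket_bilinear del: add_Pair)
    from this[of "fst u"] show ?thesis by (simp add: eh_tilde_bracket_def)
  qed
  show "eh_tilde_bracket q u (eh_tilde_bracket q v w) + eh_tilde_bracket q v (eh_tilde_bracket q w u)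
      + eh_tilde_bracket q w (eh_tilde_bracket q u v) = 0" for u v w
  proof -
    define J where "J u v w = eh_tilde_bracket q u (eh_tilde_bracket q v w)
      + eh_tilde_bracket q v (eh_tilde_bracket q w u) + eh_tilde_bracket q w (eh_tilde_bracket q u v)"
      for u v w
    have J_add: "J (u + u') v w = J u v w + J u' v w" "J v (u + u') w = J v u w + J v u' w"
      "J v w (u + u') = J v w u + J v w u'"
      and J_scale: "J (eh_tilde_scale c u) v w = eh_tilde_scale c (J u v w)"
      "J v (eh_tilde_scale c u) w = eh_tilde_scale c (J v u w)"
      "J v w (eh_tilde_scale c u) = eh_tilde_scale c (J v w u)" for u u' v w c
      by (simp_all add: J_def eh_tilde_bracket_bilinear eh_tilde.scale_right_distrib)
    have "J (f, 0) (g, 0) (h, 0) = 0" for f g h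
    proof (induction f rule: eh_induct)
      case (basis x)
      show ?case
      proof (induction g rule: eh_induct)
        case (basis y)
        show ?case
        proof (induction h rule: eh_induct)
          case (basis z)
          show ?case unfolding J_def by (rule eh_tilde_jacobi_w)
        qed (simp_all add: eh_pair_linear J_add J_scale del: add_Pair)
      qed (simp_all add: eh_pair_linear J_add J_scale del: add_Pair)
    qed (simp_all add: eh_pair_linear J_add J_scale del: add_Pair)
    from this[of "fst u" "fst v" "fst w"] show ?thesis
      by (simp add: J_def eh_tilde_bracket_def)
  qed
qed (simp_all add: eh_tilde_bracket_bilinear)

lemma eh_lie_algebra: "lie_algebra eh_scale (eh_bracket q)"
proof
  interpret T: lie_algebra eh_tilde_scale "eh_tilde_bracket q" by (rule eh_tilde_lie_algebra)
  show "eh_bracket q f f = 0" for f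
    using arg_cong[OF T.bracket_self[of "(f, 0)"], of fst] by (simp add: fst_eh_tilde_bracket)
  show "eh_bracket q f (eh_bracket q g h) + eh_bracket q g (eh_bracket q h f)
      + eh_bracket q h (eh_bracket q f g) = 0" for f g h
    using arg_cong[OF T.jacobi[of "(f, 0)" "(g, 0)" "(h, 0)"], of fst] by (simp add: fst_eh_tilde_bracket)
qed (simp_all add: eh_bracket_bilinear)

lemma eh_tilde_central_extension:
  "central_extension eh_tilde_scale (eh_tilde_bracket q) eh_scale (eh_bracket q) eh_proj"
proof -
  interpret T: lie_algebra eh_tilde_scale "eh_tilde_bracket q" by (rule eh_tilde_lie_algebra)
  interpret L: lie_algebra eh_scale "eh_bracket q" by (rule eh_lie_algebra)
  show ?thesis
  proof
    show "surj (eh_proj :: 'k eh_tilde \<Rightarrow> 'k eh)"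
      by (auto simp: eh_proj_def)
    show "eh_tilde_bracket q z x = 0" if "eh_proj z = 0" for z x
      using that by (simp add: eh_tilde_bracket_def eh_proj_def bilinear_extension_def)
  qed (simp_all add: eh_proj_def fst_eh_tilde_scale fst_eh_tilde_bracket)
qed

end


section \<open>The equation satisfied by the failure of lifts to preserve brackets\<close>

locale quantum_module = quantum_units q + idom_module scale
  for q :: "'k::idom" and scale :: "'k \<Rightarrow> 'b::ab_group_add \<Rightarrow> 'b"
begin

lemma scale_unit_cancel:
  assumes "c dvd 1" "scale c x = scale c y"
  shows "x = y"
proof -
  obtain r where "1 = c * r" using assms(1) by (elim dvdE)
  then have "r * c = 1" by (simp add: mult.commute)
  then show ?thesis using arg_cong[OF assms(2), of "scale r"] by simp
qed

lemma scale_qint_cancel: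
  "d \<noteq> 0 \<Longrightarrow> scale (qint q d) x = scale (qint q d) y \<Longrightarrow> x = y"
  using scale_unit_cancel qint_unit by blast

lemma scale_qint_eq_0: "d \<noteq> 0 \<Longrightarrow> scale (qint q d) x = 0 \<longleftrightarrow> x = 0"
  using scale_qint_cancel[of d x 0] by auto

text \<open>
  This is the Jacobi identity for lifts of total degree \<open>s\<close>, with \<open>F x\<close> in the place of
  \<open>[u x, u (s - x)]\<close>; the coefficients are the \<open>{det}\<close> of the inner brackets.
\<close>

definition defect_equation :: "int \<times> int \<Rightarrow> (int \<times> int \<Rightarrow> 'b) \<Rightarrow> bool" where
  "defect_equation s F \<longleftrightarrow> (\<forall>x y.
     scale (qint q (det2 x y + det2 y s)) (F x) + scale (qint q (det2 x y - det2 x s)) (F y)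
       = scale (qint q (det2 x y)) (F (x + y)))"

lemma defect_equationD:
  "defect_equation s F \<Longrightarrow>
     scale (qint q (det2 x y + det2 y s)) (F x) + scale (qint q (det2 x y - det2 x s)) (F y)
       = scale (qint q (det2 x y)) (F (x + y))"
  unfolding defect_equation_def by blast

lemma defect_equation_det: "defect_equation s (\<lambda>x. scale (qint q (det2 x s)) g)"
  by (simp add: defect_equation_def scale_left_distrib[symmetric] qint_addition det2_simps)

lemma defect_equation_diff:
  assumes "defect_equation s F" "defect_equation s G"
  shows "defect_equation s (\<lambda>x. F x - G x)"
  unfolding defect_equation_def
proof (intro allI)
  fix x y
  show "scale (qint q (det2 x y + det2 y s)) (F x - G x) + scale (qint q (det2 x y - det2 x s)) (F y - G y)
      = scale (qint q (det2 x y)) (F (x + y) - G (x + y))"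
    using defect_equationD[OF assms(1), of x y, symmetric] defect_equationD[OF assms(2), of x y, symmetric]
    by (simp only: scale_right_diff_distrib) (simp add: algebra_simps)
qed

text \<open>
  Here \<open>f0, f1, f2, f3\<close> are consecutive entries of the row \<open>j\<close>. With \<open>A = {j - n}\<close> and \<open>B = {j}\<close>,
  single steps give \<open>B\<^sup>2 f2 = A\<^sup>2 f0\<close>, and comparison with the double step yields \<open>2 f0 = 0\<close>. This
  alone does not suffice in modules with \<open>2\<close>-torsion. The triple step yields
  \<open>3 (B\<^sup>2 - A\<^sup>2) f0 = 0\<close>; as \<open>2 f0 = 0\<close>, the factor \<open>3\<close> may be replaced by \<open>1\<close>, and
  \<open>B\<^sup>2 - A\<^sup>2 = {n} {2 j - n}\<close> is a unit unless \<open>n = 2 j\<close>.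
\<close>

lemma defect_row_vanishes:
  assumes double: "scale (qint q (2 * (j - n))) f0 = scale (qint q (2 * j)) f2"
    and triple: "scale (qint q (3 * (j - n))) f0 = scale (qint q (3 * j)) f3"
    and step: "scale (qint q (j - n)) f0 = scale (qint q j) f1"
      "scale (qint q (j - n)) f1 = scale (qint q j) f2"
      "scale (qint q (j - n)) f2 = scale (qint q j) f3"
    and nz: "j \<noteq> 0" "j \<noteq> n" "n \<noteq> 0" "n \<noteq> 2 * j"
  shows "f0 = 0"
proof -
  define A where "A = qint q (j - n)"
  define B where "B = qint q j"
  define A' where "A' = Q (j - n) + Q (- (j - n))"
  define B' where "B' = Q j + Q (- j)"
  have st: "scale B f1 = scale A f0" "scale B f2 = scale A f1" "scale B f3 = scale A f2"
    using step by (simp_all add: A_def B_def)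
  have comm: "scale (c * d) f = scale d (scale c f)" for c d f by (simp add: mult.commute)
  have BB: "scale (B * B) f2 = scale (A * A) f0"
    by (metis comm st(1,2) scale_scale)
  have BBB: "scale (B * B * B) f3 = scale (A * A * A) f0"
    by (metis comm BB st(3) scale_scale)
  have "scale (A * A') f0 = scale (B * B') f2"
    using double by (simp only: A_def A'_def B_def B'_def qint_double)
  then have "scale (B * A * A') f0 = scale B (scale (B * B') f2)"
    by (metis mult.assoc scale_scale)
  also have "\<dots> = scale B' (scale (B * B) f2)" by (simp add: ac_simps)
  also have "\<dots> = scale (A * A * B') f0" by (simp add: BB ac_simps)
  finally have "scale (A * (B * A' - A * B')) f0 = 0"
    by (simp add: right_diff_distrib scale_left_diff_distrib ac_simps)
  then have "scale A (scale (qint q n) (scale 2 f0)) = 0"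
    using qint_double_cross[of j n] by (simp add: A_def A'_def B_def B'_def ac_simps)
  then have two: "scale 2 f0 = 0"
    using nz by (simp add: A_def scale_qint_eq_0 del: scale_scale)
  have "scale (A * (A ^ 2 + 3)) f0 = scale (B * (B ^ 2 + 3)) f3"
    using triple by (simp only: A_def B_def qint_triple)
  then have "scale (B * B * A * (A ^ 2 + 3)) f0 = scale (B * B) (scale (B * (B ^ 2 + 3)) f3)"
    by (metis mult.assoc scale_scale)
  also have "\<dots> = scale (B ^ 2 + 3) (scale (B * B * B) f3)" by (simp add: ac_simps)
  also have "\<dots> = scale ((B ^ 2 + 3) * (A * A * A)) f0" by (simp add: BBB)
  finally have "scale (B * B * A * (A ^ 2 + 3) - (B ^ 2 + 3) * (A * A * A)) f0 = 0"
    by (simp only: scale_left_diff_distrib) simp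
  also have "B * B * A * (A ^ 2 + 3) - (B ^ 2 + 3) * (A * A * A) = A * (B ^ 2 - A ^ 2) + (A * (B ^ 2 - A ^ 2)) * 2"
    by (simp add: power2_eq_square algebra_simps)
  finally have "scale (A * (B ^ 2 - A ^ 2)) f0 + scale (A * (B ^ 2 - A ^ 2)) (scale 2 f0) = 0"
    by (simp only: scale_left_distrib scale_scale)
  then have "scale A (scale (qint q n) (scale (qint q (2 * j - n)) f0)) = 0"
    using qint_square_diff[of j n] by (simp add: two A_def B_def)
  then show ?thesis
    using nz by (simp add: A_def scale_qint_eq_0 del: scale_scale)
qed

text \<open>
  The assumption \<open>F (1, 0) = 0\<close> propagates along the row \<open>0\<close>. Adding \<open>(i, 0)\<close> then multiplies the
  values in the row \<open>j\<close> by the ratio \<open>{i (j - n)} / {i j}\<close>, which must be compatible for different \<open>i\<close>.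
  For \<open>n = 2 j\<close> this ratio is \<open>-1\<close> for all \<open>i\<close>, and the comparison gives no more than \<open>2 F = 0\<close>.
\<close>

lemma normalized_defect_vanishes:
  assumes eqn: "defect_equation (0, n) F" and "n > 0" and norm: "F (1, 0) = 0"
  shows "F (k, j) = 0"
proof -
  have nz: "n \<noteq> 0" using \<open>n > 0\<close> by simp
  have R: "scale (qint q (i * j' - i' * j + i' * n)) (F (i, j)) + scale (qint q (i * j' - i' * j - i * n)) (F (i', j'))
      = scale (qint q (i * j' - i' * j)) (F (i + i', j + j'))" for i j i' j'
    using defect_equationD[OF eqn, of "(i, j)" "(i', j')"] by (simp add: det2_def)
  have row0: "F (i, 0) = 0" for i
    using R[of 1 0 i 0] norm scale_qint_cancel[of "- n" "F (i, 0)" 0] nz by simp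
  have shift: "scale (qint q (i * (j - n))) (F (k, j)) = scale (qint q (i * j)) (F (k + i, j))" for i j k
    using R[of i j k 0] row0[of i] by (simp add: algebra_simps)
  have generic: "F (k, j) = 0" if "n \<noteq> 2 * j" for k j
  proof -
    consider "j = 0" | "j = n" | "j \<noteq> 0" "j \<noteq> n" by blast
    then show ?thesis
    proof cases
      case 1
      then show ?thesis using row0 by simp
    next
      case 2
      then show ?thesis using shift[of 1 n "k - 1"] scale_qint_cancel[of n "F (k, n)" 0] nz by simp
    next
      case 3
      show ?thesis
        using shift[of 2 j k] shift[of 3 j k] shift[of 1 j k] shift[of 1 j "k + 1"] shift[of 1 j "k + 2"] 3 nz that
        by (intro defect_row_vanishes[of j n _ "F (k + 2, j)" "F (k + 3, j)" "F (k + 1, j)"])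
          (simp_all add: algebra_simps)
    qed
  qed
  show ?thesis
  proof (cases "n = 2 * j")
    case False
    then show ?thesis by (rule generic)
  next
    case True
    \<comment> \<open>Decompose \<open>(k, j) = (i, j + 1) + (k - i, -1)\<close>: both rows differ from \<open>j\<close>, and \<open>i\<close> is
      chosen so that the two summands are not parallel.\<close>
    define i where "i = (if k = 0 then 1 else 0 :: int)"
    define a where "a = - i - (j + 1) * (k - i)"
    have "j > 0" using True \<open>n > 0\<close> by simp
    have "a \<noteq> 0"
      using \<open>j > 0\<close> by (auto simp: a_def i_def)
    have "F (i, j + 1) = 0"
      by (rule generic) (simp add: True)
    moreover have "F (k - i, -1) = 0"
      by (rule generic) (use \<open>n > 0\<close> in simp)
    ultimately have "scale (qint q a) (F (k, j)) = 0"
      using R[of i "-1" "k - i" "j + 1"] by (simp add: a_def algebra_simps)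
    then show ?thesis using scale_qint_cancel[of a "F (k, j)" 0] \<open>a \<noteq> 0\<close> by simp
  qed
qed

text \<open>
  The solution is determined by its value at one vector \<open>e\<close>. Expressing the coefficient through
  \<open>F e\<close> shows that it lies in every submodule containing the values of \<open>F\<close>, in the application in
  the kernel of the extension.
\<close>

lemma defect_equation_solution:
  assumes eqn: "defect_equation s F" and "s \<noteq> 0"
  obtains e r where "\<And>x. F x = scale (qint q (det2 x s)) (scale r (F e))"
proof -
  define n where "n = gcd (fst s) (snd s)"
  have "n \<noteq> 0" using \<open>s \<noteq> 0\<close> by (cases s) (auto simp: n_def zero_prod_def)
  then have "n > 0" by (simp add: n_def)
  obtain p1 p2 where p: "fst s = n * p1" "snd s = n * p2"
    unfolding n_def by (meson dvdE gcd_dvd1 gcd_dvd2)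
  obtain u v where "u * fst s + v * snd s = n"
    using bezout_int unfolding n_def by blast
  then have "n * (u * p1 + v * p2) = n" by (simp add: p algebra_simps)
  then have uv: "u * p1 + v * p2 = 1" using \<open>n \<noteq> 0\<close> by simp
  define e where "e = (v, - u)"
  define p where "p = (p1, p2)"
  have ep: "det2 e p = 1" using uv by (simp add: e_def p_def det2_def algebra_simps)
  \<comment> \<open>The linear automorphism of \<open>\<int>\<^sup>2\<close> sending \<open>(1, 0)\<close> to \<open>e\<close> and \<open>(0, 1)\<close> to \<open>p\<close>; it preserves
    determinants and sends \<open>(0, n)\<close> to \<open>s\<close>.\<close>
  define T where "T z = (fst z * v + snd z * p1, - (fst z * u) + snd z * p2)" for z
  have T_add: "T (x + y) = T x + T y" for x y
    by (simp add: T_def algebra_simps)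
  have T_det: "det2 (T x) (T y) = det2 x y" for x y
  proof -
    have "det2 (T x) (T y) = det2 x y * (u * p1 + v * p2)"
      by (simp add: T_def det2_def algebra_simps)
    then show ?thesis by (simp add: uv)
  qed
  have T_s: "T (0, n) = s" using p by (simp add: T_def prod_eq_iff)
  have T_onto: "x = T (det2 x p, det2 e x)" for x
  proof -
    have "T (det2 x p, det2 e x) = (fst x * (u * p1 + v * p2), snd x * (u * p1 + v * p2))"
      by (simp add: T_def p_def e_def det2_def algebra_simps)
    then show ?thesis by (simp add: uv)
  qed
  obtain r where r: "1 = qint q n * r" using qint_unit[OF \<open>n \<noteq> 0\<close>] by (elim dvdE)
  define g where "g = scale r (F e)"
  define G where "G z = F (T z) - scale (qint q (det2 z (0, n))) g" for z
  have "defect_equation (0, n) (\<lambda>z. F (T z))"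
    using defect_equationD[OF eqn, of "T _" "T _"] T_det[of _ "(0, n)"]
    by (simp add: defect_equation_def T_det T_add T_s)
  then have "defect_equation (0, n) G"
    unfolding G_def by (intro defect_equation_diff defect_equation_det)
  moreover have "G (1, 0) = 0"
    using r by (simp add: G_def T_def g_def e_def det2_def)
  ultimately have "G z = 0" for z
    using normalized_defect_vanishes[OF _ \<open>n > 0\<close>] by (cases z) simp
  then have "F (T z) = scale (qint q (det2 (T z) s)) g" for z
    using T_det[of z "(0, n)"] by (simp add: G_def T_s)
  then have "F x = scale (qint q (det2 x s)) (scale r (F e))" for x
    using T_onto[of x] unfolding g_def by metis
  then show ?thesis using that by blast
qed

text \<open>
  In degree \<open>0\<close> the equation is additivity multiplied by \<open>{det(x y)}\<close>, void for parallel \<open>x\<close> and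
  \<open>y\<close>. For those, compute \<open>F (x + y + e)\<close> in two ways with \<open>e\<close> transversal to both.
\<close>

lemma defect_equation_additive:
  assumes eqn: "defect_equation 0 F" and odd: "\<And>x. F (- x) = - F x" and F0: "F 0 = 0"
  shows "F (x + y) = F x + F y"
proof -
  have transversal: "F (x + y) = F x + F y" if "det2 x y \<noteq> 0" for x y
    using defect_equationD[OF eqn, of x y] scale_qint_cancel[OF that]
    by (simp add: det2_simps flip: scale_right_distrib)
  have parallel: "det2 y e \<noteq> 0" if "det2 x y = 0" "y \<noteq> 0" "det2 x e \<noteq> 0" for x y e
  proof
    assume "det2 y e = 0"
    have "det2 x e * fst y = det2 y e * fst x + det2 x y * fst e"
      "det2 x e * snd y = det2 y e * snd x + det2 x y * snd e"
      by (simp_all add: det2_def algebra_simps)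
    with that \<open>det2 y e = 0\<close> show False by (simp add: prod_eq_iff)
  qed
  consider "x = 0 \<or> y = 0" | "y = - x" | "det2 x y \<noteq> 0"
    | "x \<noteq> 0" "y \<noteq> 0" "x + y \<noteq> 0" "det2 x y = 0"
    by (metis add_eq_0_iff)
  then show ?thesis
  proof cases
    case 4
    define e :: "int \<times> int" where "e = (if fst x = 0 then (1, 0) else (0, 1))"
    have xe: "det2 x e \<noteq> 0"
      using \<open>x \<noteq> 0\<close> by (auto simp: e_def det2_def prod_eq_iff)
    have ye: "det2 y e \<noteq> 0" and xye: "det2 (x + y) e \<noteq> 0"
      using parallel[of x y e] parallel[of x "x + y" e] 4 xe by (simp_all add: det2_simps)
    have "F (x + y) + F e = F (x + (y + e))"
      using transversal[OF xye] by (simp add: add.assoc)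
    also have "\<dots> = F x + (F y + F e)"
      using transversal[of x "y + e"] transversal[OF ye] xe 4 by (simp add: det2_simps)
    finally show ?thesis by (simp add: add.assoc)
  qed (use F0 odd transversal in auto)
qed

lemma additive_int_pair:
  assumes add: "\<And>x y. F (x + y) = F x + F y"
  shows "F (m, n) = scale (of_int m) (F (1, 0)) + scale (of_int n) (F (0, 1))"
proof -
  have F0: "F 0 = 0" using add[of 0 0] by simp
  have neg: "F (- x) = - F x" for x using add[of x "- x"] F0 by (simp add: eq_neg_iff_add_eq_0 add.commute)
  have mult: "F (m * a, m * b) = scale (of_int m) (F (a, b))" for m a b
  proof (induction m rule: int_induct[where k = 0])
    case (step1 i)
    then show ?case using add[of "(i * a, i * b)" "(a, b)"] by (simp add: algebra_simps)
  next
    case (step2 i)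
    then show ?case
      using add[of "(i * a, i * b)" "- (a, b)"] neg[of "(a, b)"] by (simp add: algebra_simps)
  qed (use F0 in \<open>simp add: zero_prod_def\<close>)
  show ?thesis using add[of "(m, 0)" "(0, n)"] mult[of m 1 0] mult[of n 0 1] by simp
qed

end


section \<open>The universal property\<close>

locale eh_central_extension =
  quantum_units q + central_extension scale br eh_scale "eh_bracket q" p
  for q :: "'k::idom" and scale :: "'k \<Rightarrow> 'c::ab_group_add \<Rightarrow> 'c" and br and p
begin

sublocale quantum_module q scale ..

lemma br_antisym: "br y x = - br x y"
  using A.bracket_self[of "x + y"]
  unfolding A.bracket_add_left A.bracket_add_right
  by (simp add: A.bracket_self eq_neg_iff_add_eq_0 add.commute)

lemma central_right: "p z = 0 \<Longrightarrow> br x z = 0"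
  using br_antisym[of z x] kernel_central by simp

text \<open>
  The bracket of an extension factors through its quotient: this is why the brackets of lifts are
  canonical although the lifts are not.
\<close>

lemma br_cong_kernel:
  assumes "p x = p x'" "p y = p y'"
  shows "br x y = br x' y'"
proof -
  have "p (x - x') = 0" "p (y - y') = 0" using assms by (simp_all add: diff)
  then have "br (x - x') y = 0" "br x' (y - y') = 0"
    by (simp_all add: kernel_central central_right)
  then show ?thesis
    using A.bracket_add_left[of "x - x'" x' y] A.bracket_add_right[of x' "y - y'" y'] by simp
qed

text \<open>
  The Jacobi identity for \<open>u x\<close>, \<open>u y\<close> and \<open>u z\<close>, where \<open>z = s - x - y\<close>, gives the equation for
  \<open>[u x, u (s - x)]\<close>; the subtracted multiple of \<open>u s\<close> is a solution on its own.
\<close>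

lemma lift_defect:
  assumes u: "\<And>x. p (u x) = eh_w x" and u0: "u 0 = 0"
  shows "defect_equation s (\<lambda>x. br (u x) (u (s - x)) - scale (qint q (det2 x s)) (u s))"
    (is "defect_equation s ?F")
  unfolding defect_equation_def
proof (intro allI)
  fix x y
  define z where "z = s - x - y"
  define a where "a = det2 x y"
  define X where "X = det2 x s"
  define Y where "Y = det2 y s"
  have dets: "det2 y z = a + Y" "det2 z x = a - X" "det2 x y = a" "det2 z s = - (X + Y)"
    by (simp_all add: z_def a_def X_def Y_def det2_def algebra_simps)
  have nested: "br (u x) (br (u y) (u z)) = scale (qint q (det2 y z)) (br (u x) (u (y + z)))" for x y z
  proof -
    have "br (u x) (br (u y) (u z)) = br (u x) (scale (qint q (det2 y z)) (u (y + z)))"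
      by (rule br_cong_kernel) (simp_all add: hom_bracket u eh_bracket_w' scale)
    then show ?thesis by (simp add: A.bracket_scale_right)
  qed
  have "scale (qint q (a + Y)) (br (u x) (u (s - x))) + scale (qint q (a - X)) (br (u y) (u (s - y)))
      + scale (qint q a) (br (u z) (u (x + y))) = 0"
    using A.jacobi[of "u x" "u y" "u z"] unfolding nested dets by (simp add: z_def algebra_simps)
  moreover have "br (u z) (u (x + y)) = - br (u (x + y)) (u (s - (x + y)))"
    using br_antisym[of "u z" "u (x + y)"] by (simp add: z_def algebra_simps)
  ultimately have "scale (qint q (a + Y)) (br (u x) (u (s - x))) + scale (qint q (a - X)) (br (u y) (u (s - y)))
      = scale (qint q a) (br (u (x + y)) (u (s - (x + y))))"
    by (simp add: eq_neg_iff_add_eq_0)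
  moreover have "scale (qint q (a + Y)) (scale (qint q X) (u s)) + scale (qint q (a - X)) (scale (qint q Y) (u s))
      = scale (qint q a) (scale (qint q (X + Y)) (u s))"
    using qint_addition[of a Y X] by (simp add: A.scale_left_distrib[symmetric])
  ultimately show "scale (qint q (det2 x y + det2 y s)) (?F x) + scale (qint q (det2 x y - det2 x s)) (?F y)
      = scale (qint q (det2 x y)) (?F (x + y))"
    unfolding det2_simps a_def[symmetric] X_def[symmetric] Y_def[symmetric]
    by (simp only: A.scale_right_diff_distrib) (simp add: algebra_simps)
qed

text \<open>
  The kernel elements \<open>k s\<close> that correct \<open>u s\<close> may be chosen independently for all \<open>s \<noteq> 0\<close>, because
  changing the lifts by central elements does not change \<open>[u x, u y]\<close>.
\<close>

lemma lifts_with_defect_only_in_degree_0: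
  obtains v where "\<And>x. p (v x) = eh_w x" "v 0 = 0"
    "\<And>x y. x + y \<noteq> 0 \<Longrightarrow> br (v x) (v y) = scale (qint q (det2 x y)) (v (x + y))"
proof -
  define u where "u x = (if x = 0 then 0 else inv p (eh_w x))" for x
  have u: "p (u x) = eh_w x" for x
    by (simp add: u_def surj_f_inv_f[OF surj])
  have u0: "u 0 = 0" by (simp add: u_def)
  define F where "F s x = br (u x) (u (s - x)) - scale (qint q (det2 x s)) (u s)" for s x
  have pF: "p (F s x) = 0" for s x
    by (simp add: F_def diff hom_bracket scale u eh_bracket_w' det2_simps)
  have "\<exists>k. p k = 0 \<and> (\<forall>x. F s x = scale (qint q (det2 x s)) k)" if nz: "s \<noteq> 0" for s
  proof -
    have "defect_equation s (F s)" unfolding F_def by (rule lift_defect[OF u u0])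
    then obtain e r where "\<And>x. F s x = scale (qint q (det2 x s)) (scale r (F s e))"
      using defect_equation_solution[OF _ nz] by blast
    moreover have "p (scale r (F s e)) = 0" by (simp add: scale pF)
    ultimately show ?thesis by blast
  qed
  then obtain k where k: "\<And>s. s \<noteq> 0 \<Longrightarrow> p (k s) = 0"
    "\<And>s x. s \<noteq> 0 \<Longrightarrow> F s x = scale (qint q (det2 x s)) (k s)" by metis
  define v where "v s = (if s = 0 then 0 else u s + k s)" for s
  have pv: "p (v x) = eh_w x" for x using k(1)[of x] by (simp add: v_def add u)
  show ?thesis
  proof
    fix x y :: "int \<times> int" assume s: "x + y \<noteq> 0"
    have "br (v x) (v y) = br (u x) (u y)" by (rule br_cong_kernel) (simp_all add: pv u)
    also have "\<dots> = F (x + y) x + scale (qint q (det2 x y)) (u (x + y))"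
      by (simp add: F_def det2_simps)
    also have "\<dots> = scale (qint q (det2 x y)) (v (x + y))"
      using k(2)[OF s, of x] s by (simp add: v_def det2_simps A.scale_right_distrib)
    finally show "br (v x) (v y) = scale (qint q (det2 x y)) (v (x + y))" .
  qed (simp_all add: pv, simp add: v_def)
qed

text \<open>
  The corrected lifts determine the map on \<open>EH\<close>; the remaining brackets \<open>L x = [v x, v (- x)]\<close> are
  additive in \<open>x\<close> and determine it on the centre.
\<close>

lemma exists_hom: "\<exists>\<phi>. lie_hom eh_tilde_scale (eh_tilde_bracket q) scale br \<phi> \<and> p \<circ> \<phi> = eh_proj"
proof -
  obtain v where v: "\<And>x. p (v x) = eh_w x" "v 0 = 0"
    "\<And>x y. x + y \<noteq> 0 \<Longrightarrow> br (v x) (v y) = scale (qint q (det2 x y)) (v (x + y))"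
    using lifts_with_defect_only_in_degree_0 by blast
  define L where "L x = br (v x) (v (- x))" for x
  have "defect_equation 0 L"
    using lift_defect[OF v(1,2), of 0] by (simp add: L_def[abs_def] v(2))
  moreover have "L (- x) = - L x" for x
    unfolding L_def using br_antisym[of "v (- x)" "v x"] by simp
  moreover have "L 0 = 0" by (simp add: L_def A.bracket_self)
  ultimately have "L (x + y) = L x + L y" for x y
    by (rule defect_equation_additive)
  then have L: "L (m, n) = scale (of_int m) (L (1, 0)) + scale (of_int n) (L (0, 1))" for m n
    by (rule additive_int_pair)
  have pL: "p (L x) = 0" for x by (simp add: L_def hom_bracket v eh_bracket_w' det2_simps)
  define M where "M = lin_ext scale (\<lambda>z. v (vec z))"
  define \<phi> where "\<phi> t = M (fst t) + (scale (fst (snd t)) (L (1, 0)) + scale (snd (snd t)) (L (0, 1)))" for t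
  have M_w: "M (eh_w x) = v x" for x
    by (simp add: M_def lin_ext_w v)
  have M_lin: "M (f + g) = M f + M g" "M (eh_scale c f) = scale c (M f)" for f g c
    by (simp_all add: M_def lin_ext_add lin_ext_scale)
  have M_0: "M 0 = 0" using M_w[of 0] by (simp add: v)
  have pM: "p (M f) = f" for f
    by (induction f rule: eh_induct) (simp_all add: M_lin M_w v add scale)
  have \<phi>_add: "\<phi> (t + t') = \<phi> t + \<phi> t'" for t t'
    by (simp add: \<phi>_def M_lin A.scale_left_distrib algebra_simps)
  have \<phi>_scale: "\<phi> (eh_tilde_scale c t) = scale c (\<phi> t)" for c t
    by (simp add: \<phi>_def M_lin eh_tilde_scale_def A.scale_right_distrib)
  have p\<phi>: "p (\<phi> t) = fst t" for t
    by (simp add: \<phi>_def add scale pL pM)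
  have hom_w: "\<phi> (eh_tilde_bracket q (eh_w x, 0) (eh_w y, 0)) = br (M (eh_w x)) (M (eh_w y))" for x y
  proof (cases "x + y = 0")
    case True
    then have "y = - x" by (simp add: add_eq_0_iff)
    then show ?thesis
      using L[of "fst x" "snd x"]
      by (simp add: eh_tilde_bracket_w' \<phi>_def M_w det2_simps zk_def L_def M_0)
  next
    case False
    then show ?thesis by (simp add: eh_tilde_bracket_w' \<phi>_def M_lin M_w v(3))
  qed
  have hom: "\<phi> (eh_tilde_bracket q (f, 0) (g, 0)) = br (M f) (M g)" for f g
  proof (induction f rule: eh_induct)
    case (basis x)
    show ?case
    proof (induction g rule: eh_induct)
      case (basis y)
      show ?case by (rule hom_w)
    qed (simp_all add: eh_pair_linear eh_tilde_bracket_bilinear \<phi>_add \<phi>_scale M_lin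
        A.bracket_add_right A.bracket_scale_right del: add_Pair)
  qed (simp_all add: eh_pair_linear eh_tilde_bracket_bilinear \<phi>_add \<phi>_scale M_lin
        A.bracket_add_left A.bracket_scale_left del: add_Pair)
  interpret T: lie_algebra eh_tilde_scale "eh_tilde_bracket q" by (rule eh_tilde_lie_algebra)
  have "\<phi> (eh_tilde_bracket q t t') = br (\<phi> t) (\<phi> t')" for t t'
  proof -
    have "br (\<phi> t) (\<phi> t') = br (M (fst t)) (M (fst t'))"
      by (rule br_cong_kernel) (simp_all add: p\<phi> pM)
    also have "\<dots> = \<phi> (eh_tilde_bracket q (fst t, 0) (fst t', 0))" by (simp add: hom)
    finally show ?thesis by (simp add: eh_tilde_bracket_def)
  qed
  moreover have "p \<circ> \<phi> = eh_proj" by (auto simp: p\<phi> eh_proj_def)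
  ultimately show ?thesis
    by (intro exI[of _ \<phi>] conjI) (unfold_locales, simp_all add: \<phi>_add \<phi>_scale)
qed

text \<open>
  Both maps agree on brackets by \<open>br_cong_kernel\<close>, and brackets span the extended algebra.
\<close>

lemma unique_hom:
  assumes "lie_hom eh_tilde_scale (eh_tilde_bracket q) scale br \<phi>" "p \<circ> \<phi> = eh_proj"
    and "lie_hom eh_tilde_scale (eh_tilde_bracket q) scale br \<psi>" "p \<circ> \<psi> = eh_proj"
  shows "\<phi> = \<psi>"
proof -
  interpret P: lie_hom eh_tilde_scale "eh_tilde_bracket q" scale br \<phi> by fact
  interpret S: lie_hom eh_tilde_scale "eh_tilde_bracket q" scale br \<psi> by fact
  have p_eq: "p (\<phi> t) = p (\<psi> t)" for t using assms(2,4) by (metis comp_apply)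
  have brackets: "\<phi> (eh_tilde_bracket q t t') = \<psi> (eh_tilde_bracket q t t')" for t t'
    by (simp add: P.hom_bracket S.hom_bracket br_cong_kernel[OF p_eq p_eq])
  have w: "\<phi> (eh_w x, 0) = \<psi> (eh_w x, 0)" for x
  proof (cases "x = 0")
    case True
    then show ?thesis using P.zero S.zero by (simp add: zero_prod_def)
  next
    case False
    define y :: "int \<times> int" where "y = (if fst x = 0 then (1, 0) else (0, 1))"
    have d: "det2 y x \<noteq> 0"
      using False by (auto simp: y_def det2_def prod_eq_iff)
    have "eh_tilde_bracket q (eh_w y, 0) (eh_w (x - y), 0) = eh_tilde_scale (qint q (det2 y x)) (eh_w x, 0)"
      using False by (simp add: eh_tilde_bracket_w' eh_tilde_scale_def zero_prod_def det2_def algebra_simps)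
    then have "scale (qint q (det2 y x)) (\<phi> (eh_w x, 0)) = scale (qint q (det2 y x)) (\<psi> (eh_w x, 0))"
      using brackets by (metis P.scale S.scale)
    then show ?thesis by (rule scale_qint_cancel[OF d])
  qed
  have f: "\<phi> (f, 0) = \<psi> (f, 0)" for f
    by (induction f rule: eh_induct)
      (simp_all add: w eh_pair_linear P.add S.add P.scale S.scale del: add_Pair)
  have z: "\<phi> (0, zk x) = \<psi> (0, zk x)" for x
    using brackets[of "(eh_w x, 0)" "(eh_w (- x), 0)"] by (simp add: eh_tilde_bracket_w')
  have "\<phi> (f, (a, b)) = \<psi> (f, (a, b))" for f a b
  proof -
    have "(f, (a, b)) = (f, 0) + (eh_tilde_scale a (0, zk (1, 0)) + eh_tilde_scale b (0, zk (0, 1)))"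
      by (simp add: eh_tilde_scale_def zk_def)
    then show ?thesis by (simp only: P.add S.add P.scale S.scale f z)
  qed
  then show ?thesis by (auto simp: fun_eq_iff)
qed

end

theorem proposition2p1:
  fixes q :: "'k::idom"
  assumes "q dvd 1"
    and "\<And>d. d \<noteq> 0 \<Longrightarrow> qint q d dvd 1"
    and "\<not> integral_over_ints q"
  shows "universal_central_extension TYPE('c::ab_group_add)
           eh_tilde_scale (eh_tilde_bracket q) eh_scale (eh_bracket q) eh_proj"
proof -
  interpret quantum_units q using assms(1,2) by unfold_locales
  show ?thesis
    unfolding universal_central_extension_def
  proof (intro conjI allI impI)
    show "central_extension eh_tilde_scale (eh_tilde_bracket q) eh_scale (eh_bracket q) eh_proj"
      by (rule eh_tilde_central_extension)
  next
    fix scaleC :: "'k \<Rightarrow> 'c \<Rightarrow> 'c" and bracketC f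
    assume "central_extension scaleC bracketC eh_scale (eh_bracket q) f"
    then interpret C: central_extension scaleC bracketC eh_scale "eh_bracket q" f .
    interpret E: eh_central_extension q scaleC bracketC f ..
    show "\<exists>!\<phi>. lie_hom eh_tilde_scale (eh_tilde_bracket q) scaleC bracketC \<phi> \<and> f \<circ> \<phi> = eh_proj"
      using E.exists_hom E.unique_hom by blast
  qed
qed

end
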